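(* For integers $n \geq k \geq 1$, the lower triangular sequence $t_{n,k}$ and its matrix inverse $t_{n,k}^{(-1)}$ satisfy $$\text{(i)}\quad t_{n,k} = \sum_{j=0}^{n} (-1)^{\lceil j/2 \rceil}\, \chi_{1,k}(n+1-G_j)\, [\,n-G_j \geq k\,]_{\delta},$$ $$\text{(ii)}\quad t_{n,k}^{(-1)} = \sum_{d=1}^{n} p(d-k)\, \mu_{n,d}.$$
   Context: For an arithmetic function $f:\mathbb{Z}^+\to\mathbb{C}$ let $T_f(x) := \sum_{1 \leq d \leq x,\ (d,x)=1} f(d)$ for $x \geq 1$. The lower triangular sequence $(t_{n,k})_{1\leq k\leq n}$ is independent of $f$ and is defined by the requirement that for every arithmetic function $f$ and every $x\geq 1$ $$T_f(x) = [q^x]\left(\frac{1}{(q;q)_\infty}\sum_{n\geq 2}\sum_{k=1}^{n-1} t_{n-1,k} f(k) q^n + f(1) q\right).$$ $t_{n,k}^{(-1)}$ denotes the entries of the inverse of the infinite lower triangular matrix $(t_{n,k})$. $\mu_{n,k}$ ($1 \leq k \leq n$) denotes the entries of the inverse of the lower triangular matrix whose $(n,k)$ entry is $1$ if $k \leq n$ and $\gcd(n+1,k)=1$, and $0$ otherwise. $\chi_{1,k}$ is the principal Dirichlet character modulo $k$: $\chi_{1,k}(m)=1$ if $\gcd(m,k)=1$ and $0$ otherwise. $G_j := \frac12\lceil \frac{j}{2}\rceil\lceil\frac{3j+1}{2}\rceil$ for $j\geq 0$ are the interleaved pentagonal numbers $0,1,2,5,7,12,15,\ldots$. $[\mathrm{cond}]_\delta$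 is $1$ if cond is true and $0$ otherwise. $(q;q)_\infty:=\prod_{m\geq1}(1-q^m)$; $p(n)=[q^n](q;q)_\infty^{-1}$ is the partition function, with $p(n)=0$ for $n<0$. *)

theory Defs
  imports "HOL-Analysis.Analysis"
begin

text \<open>Arithmetic functions on the positive integers are modelled as functions
  \<open>nat \<Rightarrow> complex\<close> whose value at \<open>0\<close> is never used.\<close>

definition rel_prime_sum :: "(nat \<Rightarrow> complex) \<Rightarrow> nat \<Rightarrow> complex" where
  "rel_prime_sum f x = (\<Sum>d | 1 \<le> d \<and> d \<le> x \<and> coprime d x. f d)"

text \<open>The product \<open>(q;q)\<^sub>\<infinity>\<close>, taken in the \<open>q\<close>-adic topology that the library puts on
  formal power series.\<close>

definition qq_inf :: "complex fps" where
  "qq_inf = (\<Prod>m. 1 - fps_X ^ (m + 1))"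

definition partition_fun :: "int \<Rightarrow> complex" where
  "partition_fun n = (if n < 0 then 0 else fps_nth (inverse qq_inf) (nat n))"

text \<open>The division by \<open>2\<close> is exact, see \<open>two_pent\<close> below.\<close>

definition pent :: "nat \<Rightarrow> int" where
  "pent j = (\<lceil>real j / 2\<rceil> * \<lceil>(3 * real j + 1) / 2\<rceil>) div 2"

definition principal_char :: "nat \<Rightarrow> int \<Rightarrow> complex" where
  "principal_char k m = of_bool (coprime m (int k))"


subsection \<open>Infinite lower triangular matrices\<close>

text \<open>Rows and columns are numbered from \<open>1\<close>; all entries outside \<open>1 \<le> k \<le> n\<close> are \<open>0\<close>,
  so that the row-times-column sum of a product can be cut off at the row index.\<close>

definition lower_tri :: "(nat \<Rightarrow> nat \<Rightarrow> complex) \<Rightarrow> bool" where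
  "lower_tri A \<longleftrightarrow> (\<forall>n k. \<not> (1 \<le> k \<and> k \<le> n) \<longrightarrow> A n k = 0)"

definition ltri_mult :: "(nat \<Rightarrow> nat \<Rightarrow> complex) \<Rightarrow> (nat \<Rightarrow> nat \<Rightarrow> complex) \<Rightarrow> nat \<Rightarrow> nat \<Rightarrow> complex" where
  "ltri_mult A B = (\<lambda>n k. \<Sum>j=1..n. A n j * B j k)"

definition ltri_id :: "nat \<Rightarrow> nat \<Rightarrow> complex" where
  "ltri_id = (\<lambda>n k. of_bool (1 \<le> n \<and> n = k))"

definition ltri_inverse :: "(nat \<Rightarrow> nat \<Rightarrow> complex) \<Rightarrow> nat \<Rightarrow> nat \<Rightarrow> complex" where
  "ltri_inverse A =
     (THE B. lower_tri B \<and> ltri_mult A B = ltri_id \<and> ltri_mult B A = ltri_id)"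

definition coprime_matrix :: "nat \<Rightarrow> nat \<Rightarrow> complex" where
  "coprime_matrix n k = of_bool (1 \<le> k \<and> k \<le> n \<and> gcd (n + 1) k = 1)"

definition mu :: "nat \<Rightarrow> nat \<Rightarrow> complex" where
  "mu = ltri_inverse coprime_matrix"


subsection \<open>The factorization matrix\<close>

text \<open>The term \<open>f(1) q\<close> is not divided by \<open>(q;q)\<^sub>\<infinity>\<close>: it only supplies \<open>T\<^sub>f(1) = f(1)\<close>.\<close>

definition factorizes_T :: "(nat \<Rightarrow> nat \<Rightarrow> complex) \<Rightarrow> bool" where
  "factorizes_T t \<longleftrightarrow>
     (\<forall>f x. x \<ge> 1 \<longrightarrow>
        rel_prime_sum f x =
          fps_nth (inverse qq_inf *
                     Abs_fps (\<lambda>n. if n \<ge> 2 then \<Sum>k=1..n-1. t (n - 1) k * f k else 0)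
                   + fps_const (f 1) * fps_X) x)"

definition tseq :: "nat \<Rightarrow> nat \<Rightarrow> complex" where
  "tseq = (THE t. lower_tri t \<and> factorizes_T t)"


subsection \<open>Well-definedness of the above\<close>

lemma two_pent: "2 * pent j = \<lceil>real j / 2\<rceil> * \<lceil>(3 * real j + 1) / 2\<rceil>"
proof -
  have "even (\<lceil>real j / 2\<rceil> * \<lceil>(3 * real j + 1) / 2\<rceil>)"
  proof (cases "even j")
    case True
    then obtain m where m: "j = 2 * m" by (rule evenE)
    have "\<lceil>real j / 2\<rceil> = int m" unfolding m by simp
    moreover have "\<lceil>(3 * real j + 1) / 2\<rceil> = 3 * int m + 1"
      unfolding m by (rule ceiling_unique) auto
    ultimately show ?thesis by simp
  next
    case False
    then obtain m where m: "j = 2 * m + 1" by (rule oddE)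
    have "\<lceil>real j / 2\<rceil> = int m + 1" unfolding m by (rule ceiling_unique) auto
    moreover have "\<lceil>(3 * real j + 1) / 2\<rceil> = 3 * int m + 2"
      unfolding m by (rule ceiling_unique) auto
    ultimately show ?thesis by simp
  qed
  thus ?thesis by (simp add: pent_def)
qed

lemma qq_inf_has_prod: "(\<lambda>m. 1 - fps_X ^ (m + 1)) has_prod qq_inf"
proof -
  define P :: "nat \<Rightarrow> complex fps" where "P = (\<lambda>n. \<Prod>i\<le>n. 1 - fps_X ^ (i + 1))"
  define L where "L = Abs_fps (\<lambda>n. fps_nth (P n) n)"
  have PS: "P (Suc m) = P m - P m * fps_X ^ Suc (Suc m)" for m
    by (simp add: P_def algebra_simps)
  have stable: "fps_nth (P m) n = fps_nth (P n) n" if "m \<ge> n" for m n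
    using that
    by (induction m rule: dec_induct) (auto simp: PS fps_X_power_mult_right_nth simp del: power_Suc)
  have lim: "P \<longlonglongrightarrow> L"
  proof (rule metric_LIMSEQ_I)
    fix e :: real assume e: "0 < e"
    obtain N where N: "inverse (2 ^ N) < e"
      using reals_power_lt_ex[of e 2] e by (auto simp: inverse_eq_divide power_one_over)
    have "dist (P m) L < e" if m: "m \<ge> N" for m
    proof (cases "P m = L")
      case True
      thus ?thesis using e by simp
    next
      case False
      have "subdegree (P m - L) \<ge> N"
      proof (rule subdegree_geI)
        show "P m - L \<noteq> 0" using False by simp
        fix i assume "i < N"
        thus "fps_nth (P m - L) i = 0"
          using stable[of i m] m by (simp add: L_def)
      qed
      hence "inverse (2 ^ subdegree (P m - L)) \<le> (inverse (2 ^ N) :: real)"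
        by (simp add: power_increasing)
      with N have "inverse (2 ^ subdegree (P m - L)) < e" by linarith
      with False show ?thesis by (simp only: dist_fps_def if_False)
    qed
    thus "\<exists>no. \<forall>n\<ge>no. dist (P n) L < e" by blast
  qed
  have "fps_nth L 0 = 1" by (simp add: L_def P_def)
  hence "L \<noteq> 0" by auto
  with lim have "raw_has_prod (\<lambda>m. 1 - fps_X ^ (m + 1)) 0 L"
    by (simp add: raw_has_prod_def P_def)
  hence "(\<lambda>m. 1 - fps_X ^ (m + 1)) has_prod L"
    by (simp add: has_prod_def)
  thus ?thesis
    unfolding qq_inf_def using has_prod_unique by metis
qed

lemma qq_inf_nth_0: "fps_nth qq_inf 0 = 1"
proof -
  have nz: "1 - fps_X ^ (m + 1) \<noteq> (0 :: complex fps)" for m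
  proof
    assume "1 - fps_X ^ (m + 1) = (0 :: complex fps)"
    hence "fps_nth (1 - fps_X ^ (m + 1) :: complex fps) 0 = 0" by simp
    thus False by simp
  qed
  have lim: "(\<lambda>n. \<Prod>i\<le>n. 1 - fps_X ^ (i + 1)) \<longlonglongrightarrow> qq_inf"
    using qq_inf_has_prod nz by (auto simp: has_prod_def raw_has_prod_def)
  obtain n where n: "dist (\<Prod>i\<le>n. 1 - fps_X ^ (i + 1)) qq_inf < 1"
    using metric_LIMSEQ_D[OF lim, of 1] by auto
  let ?p = "(\<Prod>i\<le>n. 1 - fps_X ^ (i + 1)) :: complex fps"
  have "fps_nth ?p 0 = fps_nth qq_inf 0"
  proof (cases "?p = qq_inf")
    case False
    have "subdegree (?p - qq_inf) \<noteq> 0"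
    proof
      assume "subdegree (?p - qq_inf) = 0"
      with False have "dist ?p qq_inf = 1" by (simp only: dist_fps_def) simp
      with n show False by simp
    qed
    hence "fps_nth (?p - qq_inf) 0 = 0" by (metis neq0_conv nth_less_subdegree_zero)
    thus ?thesis by simp
  qed simp
  moreover have "fps_nth ?p 0 = 1"
    by (induction n) simp_all
  ultimately show ?thesis by simp
qed

lemma ltri_mult_assoc:
  assumes "lower_tri A" "lower_tri B" "lower_tri C"
  shows "ltri_mult (ltri_mult A B) C = ltri_mult A (ltri_mult B C)"
proof (intro ext)
  fix n k
  have "ltri_mult A (ltri_mult B C) n k = (\<Sum>i=1..n. \<Sum>j=1..i. A n i * (B i j * C j k))"
    by (simp add: ltri_mult_def sum_distrib_left)
  also have "\<dots> = (\<Sum>i=1..n. \<Sum>j=1..n. A n i * (B i j * C j k))"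
    using assms(2) by (intro sum.cong refl sum.mono_neutral_left) (auto simp: lower_tri_def)
  also have "\<dots> = (\<Sum>j=1..n. \<Sum>i=1..n. A n i * (B i j * C j k))"
    by (rule sum.swap)
  also have "\<dots> = ltri_mult (ltri_mult A B) C n k"
    by (simp add: ltri_mult_def sum_distrib_right mult.assoc)
  finally show "ltri_mult (ltri_mult A B) C n k = ltri_mult A (ltri_mult B C) n k" ..
qed

lemma ltri_mult_id_right: "lower_tri A \<Longrightarrow> ltri_mult A ltri_id = A"
  by (intro ext) (auto simp: ltri_mult_def ltri_id_def lower_tri_def of_bool_def if_distrib sum.delta cong: if_cong)

lemma ltri_mult_id_left: "lower_tri A \<Longrightarrow> ltri_mult ltri_id A = A"
proof (intro ext)
  fix n k assume A: "lower_tri A"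
  have "ltri_mult ltri_id A n k = (\<Sum>j=1..n. if n = j then A j k else 0)"
    unfolding ltri_mult_def ltri_id_def by (intro sum.cong) auto
  also have "\<dots> = A n k" using A by (auto simp: lower_tri_def)
  finally show "ltri_mult ltri_id A n k = A n k" .
qed

fun ltri_rinv :: "(nat \<Rightarrow> nat \<Rightarrow> complex) \<Rightarrow> nat \<Rightarrow> nat \<Rightarrow> complex" where
  "ltri_rinv A n k = (if k < 1 \<or> n < k then 0
     else (of_bool (n = k) - (\<Sum>j\<in>{1..<n}. A n j * ltri_rinv A j k)) / A n n)"

declare ltri_rinv.simps [simp del]

lemma ltri_rinv:
  assumes "\<And>n. n \<ge> 1 \<Longrightarrow> A n n \<noteq> 0"
  shows "lower_tri (ltri_rinv A)" "ltri_mult A (ltri_rinv A) = ltri_id"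
    "n \<ge> 1 \<Longrightarrow> ltri_rinv A n n \<noteq> 0"
proof -
  show l: "lower_tri (ltri_rinv A)"
    by (auto simp: lower_tri_def ltri_rinv.simps)
  show "ltri_mult A (ltri_rinv A) = ltri_id"
  proof (intro ext)
    fix n k
    show "ltri_mult A (ltri_rinv A) n k = ltri_id n k"
    proof (cases "1 \<le> k \<and> k \<le> n")
      case False
      hence "ltri_rinv A j k = 0" if "j \<in> {1..n}" for j
        using that by (subst ltri_rinv.simps) auto
      thus ?thesis using False by (auto simp: ltri_mult_def ltri_id_def)
    next
      case True
      hence "{1..n} = insert n {1..<n}" by auto
      hence "ltri_mult A (ltri_rinv A) n k
        = A n n * ltri_rinv A n k + (\<Sum>j\<in>{1..<n}. A n j * ltri_rinv A j k)"
        by (simp add: ltri_mult_def)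
      also have "\<dots> = of_bool (n = k)"
        using True assms[of n] by (subst ltri_rinv.simps) (simp add: not_less)
      finally show ?thesis using True by (simp add: ltri_id_def)
    qed
  qed
  show "ltri_rinv A n n \<noteq> 0" if "n \<ge> 1"
  proof -
    have "(\<Sum>j\<in>{1..<n}. A n j * ltri_rinv A j n) = 0"
      using l by (intro sum.neutral) (auto simp: lower_tri_def)
    thus ?thesis using that assms[of n] by (subst ltri_rinv.simps) auto
  qed
qed

lemma ltri_inverse_ex1:
  assumes A: "lower_tri A" and d: "\<And>n. n \<ge> 1 \<Longrightarrow> A n n \<noteq> 0"
  shows "\<exists>!B. lower_tri B \<and> ltri_mult A B = ltri_id \<and> ltri_mult B A = ltri_id"
proof -
  define C where "C = ltri_rinv A"
  define D where "D = ltri_rinv C"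
  have C: "lower_tri C" "ltri_mult A C = ltri_id" "\<And>n. n \<ge> 1 \<Longrightarrow> C n n \<noteq> 0"
    unfolding C_def using ltri_rinv[of A] d by auto
  have D: "lower_tri D" "ltri_mult C D = ltri_id"
    unfolding D_def using ltri_rinv[of C] C(3) by auto
  have "A = D"
    using ltri_mult_assoc[OF A C(1) D(1)] C D A
    by (simp add: ltri_mult_id_right ltri_mult_id_left)
  with D C have *: "lower_tri C \<and> ltri_mult A C = ltri_id \<and> ltri_mult C A = ltri_id" by simp
  show ?thesis
  proof (rule ex1I, rule *)
    fix B assume B: "lower_tri B \<and> ltri_mult A B = ltri_id \<and> ltri_mult B A = ltri_id"
    with ltri_mult_assoc[of B A C] A * show "B = C"
      by (simp add: ltri_mult_id_right ltri_mult_id_left)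
  qed
qed

lemma coprime_matrix_ltri:
  "lower_tri coprime_matrix" "n \<ge> 1 \<Longrightarrow> coprime_matrix n n \<noteq> 0"
  by (auto simp: lower_tri_def coprime_matrix_def)

lemma tseq_ex1: "\<exists>!t. lower_tri t \<and> factorizes_T t"
proof -
  define S where "S = (\<lambda>(t :: nat \<Rightarrow> nat \<Rightarrow> complex) (f :: nat \<Rightarrow> complex).
     Abs_fps (\<lambda>n. if n \<ge> 2 then \<Sum>k=1..n-1. t (n - 1) k * f k else 0))"
  have S0: "fps_nth (S t f) 0 = 0" for t f by (simp add: S_def)
  have fact: "factorizes_T t \<longleftrightarrow> (\<forall>f x. x \<ge> 1 \<longrightarrow> rel_prime_sum f x =
      fps_nth (inverse qq_inf * S t f + fps_const (f 1) * fps_X) x)" for t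
    by (simp add: factorizes_T_def S_def)
  have E: "inverse qq_inf * qq_inf = 1"
    by (rule inverse_mult_eq_1) (simp add: qq_inf_nth_0)
  define H :: "nat \<Rightarrow> complex fps" where
    "H = (\<lambda>k. Abs_fps (\<lambda>x. of_bool (k < x \<and> coprime k x)))"
  define t0 where "t0 = (\<lambda>n k. if 1 \<le> k \<and> k \<le> n then fps_nth (qq_inf * H k) (n + 1) else 0)"
  have "lower_tri t0" by (auto simp: t0_def lower_tri_def)
  moreover have "factorizes_T t0"
    unfolding fact
  proof (intro allI impI)
    fix f :: "nat \<Rightarrow> complex" and x :: nat assume x: "x \<ge> 1"
    define F where "F = Abs_fps (\<lambda>x. if x \<ge> 2 then rel_prime_sum f x else 0)"
    have F: "fps_nth F m = (\<Sum>k=1..n. f k * fps_nth (H k) m)" if "m \<le> n" for m n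
    proof (cases "m \<ge> 2")
      case True
      have "d < m" if "coprime d m" "d \<le> m" for d
        using that True by (cases "d = m") auto
      hence "fps_nth F m = (\<Sum>k | 1 \<le> k \<and> k < m \<and> coprime k m. f k * fps_nth (H k) m)"
        using True unfolding F_def rel_prime_sum_def
        by (auto simp: H_def intro!: sum.cong)
      also have "\<dots> = (\<Sum>k=1..n. f k * fps_nth (H k) m)"
        using that by (intro sum.mono_neutral_left) (auto simp: H_def)
      finally show ?thesis .
    next
      case False
      thus ?thesis by (auto simp: F_def H_def intro!: sum.neutral[symmetric])
    qed
    have "S t0 f = qq_inf * F"
    proof (rule fps_ext)
      fix n
      have "fps_nth (qq_inf * F) n = (\<Sum>i=0..n. \<Sum>k=1..n. fps_nth qq_inf i * (f k * fps_nth (H k) (n - i)))"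
        unfolding fps_mult_nth by (intro sum.cong refl) (simp add: F[of _ n] sum_distrib_left)
      also have "\<dots> = (\<Sum>k=1..n. f k * fps_nth (qq_inf * H k) n)"
        unfolding fps_mult_nth by (subst sum.swap) (simp add: sum_distrib_left mult_ac)
      also have "\<dots> = (\<Sum>k\<in>{1..<n}. f k * fps_nth (qq_inf * H k) n)"
      proof (rule sum.mono_neutral_right)
        have "fps_nth (qq_inf * H k) n = 0" if "k \<ge> n" for k
        proof -
          have "fps_nth (H k) (n - i) = 0" for i
            using that by (auto simp: H_def)
          thus ?thesis by (simp add: fps_mult_nth)
        qed
        thus "\<forall>k\<in>{1..n} - {1..<n}. f k * fps_nth (qq_inf * H k) n = 0"
          by auto
      qed auto
      also have "\<dots> = fps_nth (S t0 f) n"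
      proof (cases "n \<ge> 2")
        case True
        hence "{1..<n} = {1..n-1}" by auto
        with True show ?thesis by (auto simp: S_def t0_def intro!: sum.cong)
      next
        case False
        thus ?thesis by (simp add: S_def)
      qed
      finally show "fps_nth (S t0 f) n = fps_nth (qq_inf * F) n" ..
    qed
    hence "inverse qq_inf * S t0 f = F"
      using E by (simp add: mult.assoc[symmetric])
    moreover have "rel_prime_sum f 1 = f 1"
    proof -
      have "{d. 1 \<le> d \<and> d \<le> 1 \<and> coprime d 1} = {1::nat}" by auto
      thus ?thesis by (simp add: rel_prime_sum_def)
    qed
    ultimately show "rel_prime_sum f x =
      fps_nth (inverse qq_inf * S t0 f + fps_const (f 1) * fps_X) x"
      using x by (cases "x = 1") (auto simp: F_def)
  qed
  ultimately have ex: "lower_tri t0 \<and> factorizes_T t0" ..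
  show ?thesis
  proof (rule ex1I, rule ex)
    fix t assume t: "lower_tri t \<and> factorizes_T t"
    have SS: "S t f = S t0 f" for f
    proof -
      have "inverse qq_inf * S t f = inverse qq_inf * S t0 f"
      proof (rule fps_ext)
        fix x
        show "fps_nth (inverse qq_inf * S t f) x = fps_nth (inverse qq_inf * S t0 f) x"
        proof (cases "x \<ge> 1")
          case True
          with t ex show ?thesis by (simp add: fact)
        next
          case False
          hence "x = 0" by simp
          thus ?thesis by (simp add: S0)
        qed
      qed
      hence "(qq_inf * inverse qq_inf) * S t f = (qq_inf * inverse qq_inf) * S t0 f"
        by (simp only: mult.assoc)
      thus ?thesis using E qq_inf_nth_0 by (auto simp: mult.commute)
    qed
    show "t = t0"
    proof (intro ext)
      fix n k
      show "t n k = t0 n k"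
      proof (cases "1 \<le> k \<and> k \<le> n")
        case True
        have "fps_nth (S u (\<lambda>i. of_bool (i = k))) (n + 1) = u n k" for u
          using True by (simp add: S_def of_bool_def if_distrib sum.delta cong: if_cong)
        thus ?thesis using SS by metis
      next
        case False
        thus ?thesis using t ex by (auto simp: lower_tri_def)
      qed
    qed
  qed
qed

lemma tseq: "lower_tri tseq" "factorizes_T tseq"
  using theI'[OF tseq_ex1] by (simp_all add: tseq_def)

lemma tseq_diag:
  assumes "n \<ge> 1"
  shows "tseq n n \<noteq> 0"
proof -
  define f :: "nat \<Rightarrow> complex" where "f = (\<lambda>i. of_bool (i = n))"
  define S where "S = Abs_fps (\<lambda>m. if m \<ge> 2 then \<Sum>k=1..m-1. tseq (m - 1) k * f k else 0)"
  have S: "fps_nth S m = tseq (m - 1) n" for m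
    using assms tseq(1)
    by (auto simp: S_def f_def of_bool_def if_distrib sum.delta lower_tri_def cong: if_cong)
  have "rel_prime_sum f (n + 1) = (\<Sum>d | 1 \<le> d \<and> d \<le> n + 1 \<and> coprime d (n + 1). if n = d then 1 else 0)"
    unfolding rel_prime_sum_def f_def by (intro sum.cong) auto
  also have "\<dots> = 1"
    using assms by (subst sum.delta') auto
  finally have 1: "rel_prime_sum f (n + 1) = 1" .
  have "fps_nth (inverse qq_inf * S) (n + 1) = (\<Sum>i\<in>{0}. fps_nth (inverse qq_inf) i * fps_nth S (n + 1 - i))"
    unfolding fps_mult_nth
  proof (rule sum.mono_neutral_right)
    have "tseq (n - i) n = 0" if "i > 0" for i
    proof -
      have "\<not> n \<le> n - i" using that assms by auto
      thus ?thesis using tseq(1) unfolding lower_tri_def by blast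
    qed
    thus "\<forall>i\<in>{0..n + 1} - {0}. fps_nth (inverse qq_inf) i * fps_nth S (n + 1 - i) = 0"
      by (auto simp: S)
  qed auto
  also have "\<dots> = tseq n n" by (simp add: S qq_inf_nth_0)
  finally have "fps_nth (inverse qq_inf * S + fps_const (f 1) * fps_X) (n + 1) = tseq n n"
    using assms by simp
  moreover have "rel_prime_sum f (n + 1) =
      fps_nth (inverse qq_inf * S + fps_const (f 1) * fps_X) (n + 1)"
    using tseq(2) by (simp add: factorizes_T_def S_def)
  ultimately show ?thesis using 1 by simp
qed

end

theory Submission
  imports Defs
begin

text \<open>The generating function of column \<open>k\<close> of \<open>tseq\<close> is \<open>(q;q)\<^sub>\<infinity>\<close> times that of
  column \<open>k\<close> of the coprimality matrix \<open>C\<close>, so \<open>tseq = A C\<close> with \<open>A\<close> the Toeplitz matrix of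
  \<open>(q;q)\<^sub>\<infinity>\<close>. The entries of \<open>A\<close> are given by the pentagonal number theorem, and its inverse is
  the Toeplitz matrix of the partition function, whence \<open>tseq\<inverse> = C\<inverse> A\<inverse>\<close>.
  The pentagonal number theorem follows from Shanks' finite version
  \<open>(\<Sum>r\<le>m. (-1)^r * q^(r*m + r*(r+1)/2) * (1 - q^(r+1)) \<cdots> (1 - q^m)) = (\<Sum>j\<le>2*m. \<plusminus> q^(G j))\<close>,
  in which the summands with \<open>r \<ge> 1\<close> vanish modulo \<open>q^(m+1)\<close>; the step from \<open>m\<close> to \<open>m + 1\<close>
  telescopes.\<close>

subsection \<open>The pentagonal number theorem\<close>

lemma ceiling_half_nat: "\<lceil>real j / 2\<rceil> = int ((j + 1) div 2)"
proof (cases "even j")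
  case True
  then obtain m where "j = 2 * m" by (rule evenE)
  thus ?thesis by simp
next
  case False
  then obtain m where m: "j = 2 * m + 1" by (rule oddE)
  show ?thesis unfolding m by (rule ceiling_unique) auto
qed

lemma two_sum_atMost_nat: "2 * \<Sum>{..n::nat} = n * (n + 1)"
  by (induction n) auto

text \<open>The right-hand side is the exponent \<open>r * m + \<Sum>{..r}\<close> at
  \<open>r = m + 1\<close>, the shape in which the boundary term of the telescoping sum in
  \<open>shanks_pentagonal\<close> appears; \<open>pent_even\<close> does the same for
  \<open>r = m\<close>.\<close>

lemma pent_odd: "pent (2 * m + 1) = int ((m + 1) * m + \<Sum>{..m + 1})"
proof -
  have "\<lceil>real (2 * m + 1) / 2\<rceil> = int m + 1" by (rule ceiling_unique) auto
  moreover have "\<lceil>(3 * real (2 * m + 1) + 1) / 2\<rceil> = 3 * int m + 2" by (rule ceiling_unique) auto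
  ultimately have "2 * pent (2 * m + 1) = (int m + 1) * (3 * int m + 2)"
    using two_pent[of "2 * m + 1"] by simp
  moreover have "2 * int (\<Sum>{..m + 1}) = (int m + 1) * (int m + 2)"
    using arg_cong[OF two_sum_atMost_nat[of "m + 1"], of int] by (simp add: algebra_simps)
  ultimately have "2 * pent (2 * m + 1) = 2 * int ((m + 1) * m + \<Sum>{..m + 1})"
    by (simp add: algebra_simps)
  thus ?thesis by simp
qed

lemma pent_even: "pent (2 * m) = int (m * m + \<Sum>{..m})"
proof -
  have "\<lceil>real (2 * m) / 2\<rceil> = int m" by simp
  moreover have "\<lceil>(3 * real (2 * m) + 1) / 2\<rceil> = 3 * int m + 1" by (rule ceiling_unique) auto
  ultimately have "2 * pent (2 * m) = int m * (3 * int m + 1)"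
    using two_pent[of "2 * m"] by simp
  moreover have "2 * int (\<Sum>{..m}) = int m * (int m + 1)"
    using arg_cong[OF two_sum_atMost_nat[of m], of int] by (simp add: algebra_simps)
  ultimately have "2 * pent (2 * m) = 2 * int (m * m + \<Sum>{..m})"
    by (simp add: algebra_simps)
  thus ?thesis by simp
qed

text \<open>Serves to cut off sums over \<open>j\<close>, and gives nonnegativity, so that
  \<open>nat (pent j)\<close> loses nothing.\<close>

lemma pent_ge: "pent j \<ge> int j"
proof (cases "even j")
  case True
  then obtain m where m: "j = 2 * m" by (rule evenE)
  have "2 * m \<le> m * m + \<Sum>{..m}"
    using two_sum_atMost_nat[of m] by (cases m) (auto simp: algebra_simps)
  thus ?thesis unfolding m pent_even by linarith
next
  case False
  then obtain m where m: "j = 2 * m + 1" by (rule oddE)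
  have "2 * m + 1 \<le> (m + 1) * m + \<Sum>{..m + 1}"
    using two_sum_atMost_nat[of "m + 1"] by (cases m) (auto simp: algebra_simps)
  thus ?thesis unfolding m pent_odd by linarith
qed

lemma shanks_pentagonal:
  fixes q :: "'a :: comm_ring_1"
  shows "(\<Sum>r\<le>m. (-1) ^ r * q ^ (r * m + \<Sum>{..r}) * (\<Prod>i\<in>{r<..m}. 1 - q ^ i))
    = (\<Sum>j\<le>2 * m. (-1) ^ ((j + 1) div 2) * q ^ nat (pent j))"
proof (induction m)
  case 0
  show ?case using pent_even[of 0] by simp
next
  case (Suc m)
  define W where "W r n = (\<Prod>i\<in>{r<..n}. 1 - q ^ i)" for r n
  define F where "F n r = (-1) ^ r * q ^ (r * n + \<Sum>{..r}) * W r n" for n r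
  \<comment> \<open>\<open>h\<close> is the antidifference in \<open>r\<close> of
    \<open>F (Suc m) r - F m r\<close>. The value at \<open>0\<close> is set separately because
    \<open>r - 1\<close> truncates there, while \<open>h_low\<close> needs
    \<open>h 0 = 0\<close>.\<close>
  define h where "h r = (if r = 0 then 0 else (-1) ^ r * q ^ (r * m + \<Sum>{..r}) * W (r - 1) m)" for r
  have W_upper: "W r (Suc m) = W r m * (1 - q ^ Suc m)" if "r \<le> m" for r
  proof -
    have "{r<..Suc m} = insert (Suc m) {r<..m}" using that by auto
    thus ?thesis by (simp add: W_def mult.commute)
  qed
  have W_lower: "W r m = W (Suc r) m * (1 - q ^ Suc r)" if "r < m" for r
  proof -
    have "{r<..m} = insert (Suc r) {Suc r<..m}" using that by auto
    thus ?thesis by (simp add: W_def mult.commute)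
  qed
  have h_low: "h r = F m r * (1 - q ^ r)" if "r \<le> m" for r
  proof (cases r)
    case (Suc s)
    with that W_lower[of s] show ?thesis by (simp add: h_def F_def mult_ac)
  qed (simp add: h_def)
  \<comment> \<open>Raising \<open>r\<close> by one adds \<open>m + (r + 1)\<close> to the exponent
    and flips the sign; the product \<open>W r m\<close> stays the same.\<close>
  have h_Suc: "h (Suc r) = - (F m r * q ^ (Suc m + r))" if "r \<le> m" for r
    by (simp add: h_def F_def power_add mult_ac)
  have step: "F (Suc m) r - F m r = h (Suc r) - h r" if "r \<le> m" for r
  proof -
    have "F (Suc m) r = F m r * q ^ r * (1 - q ^ Suc m)"
      by (simp add: F_def W_upper[OF that] power_add mult_ac)
    thus ?thesis
      unfolding h_low[OF that] h_Suc[OF that] power_add by (simp add: algebra_simps)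
  qed
  have "(\<Sum>r\<le>m. F (Suc m) r) - (\<Sum>r\<le>m. F m r) = (\<Sum>r\<le>m. h (Suc r) - h r)"
    unfolding sum_subtractf[symmetric] by (intro sum.cong refl step) simp
  also have "\<dots> = h (Suc m) - h 0"
    using sum_lessThan_telescope[of h "Suc m"] by (simp only: lessThan_Suc_atMost)
  also have "h 0 = 0" by (simp add: h_def)
  finally have "(\<Sum>r\<le>m. F (Suc m) r) = (\<Sum>r\<le>m. F m r) + h (Suc m)"
    by (simp only: diff_zero diff_eq_eq add.commute)
  hence "(\<Sum>r\<le>Suc m. F (Suc m) r) = (\<Sum>r\<le>m. F m r) + h (Suc m) + F (Suc m) (Suc m)"
    by simp
  \<comment> \<open>The two boundary terms have empty products and supply exactly the new summands
    \<open>j = 2 * m + 1\<close> and \<open>j = 2 * m + 2\<close>.\<close>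
  also have "h (Suc m) = (-1) ^ Suc m * q ^ nat (pent (2 * m + 1))"
    unfolding pent_odd nat_int by (simp add: h_def W_def)
  also have "F (Suc m) (Suc m) = (-1) ^ Suc m * q ^ nat (pent (2 * Suc m))"
    unfolding pent_even nat_int by (simp add: F_def W_def)
  also have "(\<Sum>r\<le>m. F m r) = (\<Sum>j\<le>2 * m. (-1) ^ ((j + 1) div 2) * q ^ nat (pent j))"
    unfolding F_def W_def by (rule Suc.IH)
  finally show ?case unfolding F_def W_def by simp
qed

text \<open>A factor \<open>1 - fps_X ^ i\<close> with \<open>i > n\<close> leaves the coefficient
  at \<open>n\<close> unchanged, and convergence of power series means that each coefficient is
  eventually constant.\<close>

lemma fps_nth_qq_inf:
  assumes "n \<le> m"
  shows "fps_nth qq_inf n = fps_nth (\<Prod>i\<in>{0<..m}. 1 - fps_X ^ i) n"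
proof -
  define P :: "nat \<Rightarrow> complex fps" where "P N = (\<Prod>i\<in>{0<..N}. 1 - fps_X ^ i)" for N
  have Suc_P: "P (Suc N) = P N - P N * fps_X ^ Suc N" for N
  proof -
    have "{0<..Suc N} = insert (Suc N) {0<..N}" by auto
    thus ?thesis by (simp add: P_def algebra_simps)
  qed
  have stable: "fps_nth (P N) n = fps_nth (P m) n" if "N \<ge> m" for N
    using that assms
    by (induction N rule: dec_induct) (auto simp: Suc_P fps_X_power_mult_right_nth simp del: power_Suc)
  \<comment> \<open>Excludes the case of \<open>has_prod\<close> in which a zero factor is skipped,
    so that the partial products themselves converge to \<open>qq_inf\<close>.\<close>
  have nz: "1 - fps_X ^ (i + 1) \<noteq> (0 :: complex fps)" for i
  proof
    assume "1 - fps_X ^ (i + 1) = (0 :: complex fps)"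
    hence "fps_nth (1 - fps_X ^ (i + 1) :: complex fps) 0 = 0" by simp
    thus False by simp
  qed
  have "P (Suc N) = (\<Prod>i\<le>N. 1 - fps_X ^ (i + 1))" for N
    unfolding P_def by (rule prod.reindex_bij_witness[of _ Suc "\<lambda>i. i - 1"]) auto
  hence "(\<lambda>N. P (Suc N)) \<longlonglongrightarrow> qq_inf"
    using qq_inf_has_prod nz by (auto simp: has_prod_def raw_has_prod_def)
  hence "P \<longlonglongrightarrow> qq_inf" by (simp only: filterlim_sequentially_Suc)
  hence "\<forall>\<^sub>F N in sequentially. fps_nth (P N) n = fps_nth qq_inf n"
    by (simp add: tendsto_fps_iff)
  then obtain N where "N \<ge> m" "fps_nth (P N) n = fps_nth qq_inf n"
    unfolding eventually_sequentially by (meson le_cases order_refl)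
  with stable[of N] have "fps_nth qq_inf n = fps_nth (P m) n" by (simp only:)
  thus ?thesis by (simp only: P_def)
qed

theorem pentagonal_number_theorem:
  assumes "n \<le> m"
  shows "fps_nth qq_inf n = (\<Sum>j\<le>2 * m. (-1) ^ ((j + 1) div 2) * of_bool (pent j = int n))"
proof -
  let ?F = "\<lambda>r. (-1) ^ r * fps_X ^ (r * m + \<Sum>{..r}) * (\<Prod>i\<in>{r<..m}. 1 - fps_X ^ i) :: complex fps"
  have sgn: "(-1) ^ e = fps_const ((-1) ^ e :: complex)" for e
    by (metis fps_const_neg fps_const_1_eq_1 fps_const_power)
  have F: "fps_nth (?F r) n = 0" if "r \<noteq> 0" for r
  proof -
    \<comment> \<open>For \<open>r \<ge> 1\<close> the first summand is at least
      \<open>m \<ge> n\<close> and the second is positive, so only \<open>r = 0\<close> reaches the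
      coefficient at \<open>n\<close>.\<close>
    have "n < r * m + \<Sum>{..r}"
    proof -
      have "r * m \<ge> m" using that by (cases r) auto
      moreover have "\<Sum>{..r} > 0" using that by (cases r) auto
      ultimately show ?thesis using assms by linarith
    qed
    thus ?thesis by (simp add: sgn mult.assoc fps_X_power_mult_nth)
  qed
  have "fps_nth qq_inf n = fps_nth (?F 0) n"
    by (simp add: fps_nth_qq_inf[OF assms])
  also have "\<dots> = (\<Sum>r\<in>{0}. fps_nth (?F r) n)" by simp
  also have "\<dots> = (\<Sum>r\<le>m. fps_nth (?F r) n)"
    by (rule sum.mono_neutral_left) (use F in auto)
  also have "\<dots> = fps_nth (\<Sum>j\<le>2 * m. (-1) ^ ((j + 1) div 2) * fps_X ^ nat (pent j)) n"
    unfolding fps_sum_nth[symmetric] shanks_pentagonal ..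
  also have "\<dots> = (\<Sum>j\<le>2 * m. (-1) ^ ((j + 1) div 2) * of_bool (pent j = int n))"
    unfolding fps_sum_nth
  proof (intro sum.cong refl)
    fix j
    have "n = nat (pent j) \<longleftrightarrow> pent j = int n" using pent_ge[of j] by auto
    thus "fps_nth ((-1) ^ ((j + 1) div 2) * fps_X ^ nat (pent j)) n
      = (-1) ^ ((j + 1) div 2) * (of_bool (pent j = int n) :: complex)"
      by (simp add: sgn fps_X_power_nth)
  qed
  finally show ?thesis .
qed

subsection \<open>Toeplitz matrices and their inverses\<close>

definition ltri_toeplitz :: "complex fps \<Rightarrow> nat \<Rightarrow> nat \<Rightarrow> complex" where
  "ltri_toeplitz a n k = (if 1 \<le> k \<and> k \<le> n then fps_nth a (n - k) else 0)"

lemma lower_tri_toeplitz: "lower_tri (ltri_toeplitz a)"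
  by (auto simp: lower_tri_def ltri_toeplitz_def)

text \<open>Each entry of the product is a Cauchy convolution, so inverting a power series inverts
  its matrix.\<close>

lemma ltri_toeplitz_mult: "ltri_mult (ltri_toeplitz a) (ltri_toeplitz b) = ltri_toeplitz (a * b)"
proof (intro ext)
  fix n k
  show "ltri_mult (ltri_toeplitz a) (ltri_toeplitz b) n k = ltri_toeplitz (a * b) n k"
  proof (cases "1 \<le> k \<and> k \<le> n")
    case True
    have "ltri_mult (ltri_toeplitz a) (ltri_toeplitz b) n k
      = (\<Sum>j=k..n. fps_nth a (n - j) * fps_nth b (j - k))"
      unfolding ltri_mult_def
      by (rule sum.mono_neutral_cong_right) (use True in \<open>auto simp: ltri_toeplitz_def\<close>)
    also have "\<dots> = (\<Sum>i=0..n - k. fps_nth a i * fps_nth b (n - k - i))"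
      by (rule sum.reindex_bij_witness[of _ "\<lambda>i. n - i" "\<lambda>j. n - j"]) (use True in auto)
    finally show ?thesis using True by (simp add: ltri_toeplitz_def fps_mult_nth)
  qed (auto simp: ltri_mult_def ltri_toeplitz_def intro!: sum.neutral)
qed

lemma ltri_toeplitz_1: "ltri_toeplitz 1 = ltri_id"
  by (intro ext) (auto simp: ltri_toeplitz_def ltri_id_def)

section \<open>Inverses of products of lower triangular matrices\<close>

lemma lower_tri_mult:
  assumes "lower_tri A" "lower_tri B"
  shows "lower_tri (ltri_mult A B)"
  unfolding lower_tri_def
proof (intro allI impI)
  fix n k :: nat assume nk: "\<not> (1 \<le> k \<and> k \<le> n)"
  have "A n j * B j k = 0" if "j \<in> {1..n}" for j
  proof -
    have "\<not> (1 \<le> k \<and> k \<le> j)" using nk that by auto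
    thus ?thesis using assms(2) by (simp add: lower_tri_def)
  qed
  thus "ltri_mult A B n k = 0" unfolding ltri_mult_def by (rule sum.neutral[OF ballI])
qed

lemma ltri_inverse_eqI:
  assumes "lower_tri A" "lower_tri B" "ltri_mult A B = ltri_id" "ltri_mult B A = ltri_id"
  shows "ltri_inverse A = B"
  unfolding ltri_inverse_def
proof (rule the_equality)
  fix C assume C: "lower_tri C \<and> ltri_mult A C = ltri_id \<and> ltri_mult C A = ltri_id"
  thus "C = B"
    using ltri_mult_assoc[of C A B] assms by (simp add: ltri_mult_id_right ltri_mult_id_left)
qed (use assms in simp)

lemma ltri_inverse_mult:
  assumes "lower_tri A" "lower_tri A'" "ltri_mult A A' = ltri_id" "ltri_mult A' A = ltri_id"
    and "lower_tri B" "lower_tri B'" "ltri_mult B B' = ltri_id" "ltri_mult B' B = ltri_id"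
  shows "ltri_inverse (ltri_mult A B) = ltri_mult B' A'"
proof (rule ltri_inverse_eqI)
  have "ltri_mult (ltri_mult A B) (ltri_mult B' A') = ltri_mult A (ltri_mult (ltri_mult B B') A')"
    using assms(1,2,5,6) by (simp add: ltri_mult_assoc lower_tri_mult)
  also have "\<dots> = ltri_id" using assms(2,3,7) by (simp add: ltri_mult_id_left)
  finally show "ltri_mult (ltri_mult A B) (ltri_mult B' A') = ltri_id" .
  have "ltri_mult (ltri_mult B' A') (ltri_mult A B) = ltri_mult B' (ltri_mult (ltri_mult A' A) B)"
    using assms(1,2,5,6) by (simp add: ltri_mult_assoc lower_tri_mult)
  also have "\<dots> = ltri_id" using assms(4,5,8) by (simp add: ltri_mult_id_left)
  finally show "ltri_mult (ltri_mult B' A') (ltri_mult A B) = ltri_id" .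
qed (use assms in \<open>simp_all add: lower_tri_mult\<close>)

lemma mu:
  "lower_tri mu" "ltri_mult coprime_matrix mu = ltri_id" "ltri_mult mu coprime_matrix = ltri_id"
  using theI'[OF ltri_inverse_ex1[OF coprime_matrix_ltri]]
  by (simp_all add: mu_def ltri_inverse_def)

subsection \<open>Factorization of the matrix\<close>

text \<open>Testing the defining identity on the indicator function of \<open>k\<close> isolates
  column \<open>k\<close>.\<close>

lemma tseq_conv_coeff:
  assumes "1 \<le> k"
  shows "tseq n k = fps_nth (qq_inf * Abs_fps (\<lambda>x. of_bool (k < x \<and> coprime k x))) (n + 1)"
proof -
  define f :: "nat \<Rightarrow> complex" where "f = (\<lambda>i. of_bool (i = k))"
  define S where "S = Abs_fps (\<lambda>m. if m \<ge> 2 then \<Sum>i=1..m-1. tseq (m - 1) i * f i else 0)"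
  define H :: "complex fps" where "H = Abs_fps (\<lambda>x. of_bool (k < x \<and> coprime k x))"
  \<comment> \<open>Triangularity absorbs both the guard \<open>m \<ge> 2\<close> and the range of
    the inner sum: outside them the entry is \<open>0\<close>.\<close>
  have S: "fps_nth S m = tseq (m - 1) k" for m
    using assms tseq(1)
    by (auto simp: S_def f_def of_bool_def if_distrib sum.delta lower_tri_def cong: if_cong)
  have "inverse qq_inf * S = H"
  proof (rule fps_ext)
    fix x
    show "fps_nth (inverse qq_inf * S) x = fps_nth H x"
    proof (cases "x = 0")
      case True
      thus ?thesis by (simp add: H_def S_def)
    next
      case False
      have "rel_prime_sum f x = (\<Sum>d | 1 \<le> d \<and> d \<le> x \<and> coprime d x. if k = d then 1 else 0)"
        unfolding rel_prime_sum_def f_def by (intro sum.cong) auto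
      also have "\<dots> = of_bool (k \<le> x \<and> coprime k x)"
        using assms by (subst sum.delta') auto
      finally have "of_bool (k \<le> x \<and> coprime k x) =
          fps_nth (inverse qq_inf * S + fps_const (f 1) * fps_X) x"
        using tseq(2)[unfolded factorizes_T_def, rule_format, of x f] False
        unfolding S_def by simp
      \<comment> \<open>The strict \<open>k < x\<close> in \<open>H\<close> and the
        \<open>k \<le> x\<close> above differ only at \<open>k = x = 1\<close>, which the term
        \<open>f(1) q\<close> accounts for.\<close>
      thus ?thesis using assms
        by (cases "k = x") (auto simp: H_def f_def split: if_splits)
    qed
  qed
  hence "qq_inf * H = (qq_inf * inverse qq_inf) * S" by (simp only: mult.assoc)
  also have "qq_inf * inverse qq_inf = 1"
    by (subst mult.commute, rule inverse_mult_eq_1) (simp add: qq_inf_nth_0)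
  finally show ?thesis unfolding H_def using S[of "n + 1"] by simp
qed

lemma tseq_factorization: "tseq = ltri_mult (ltri_toeplitz qq_inf) coprime_matrix"
proof (intro ext)
  fix n k
  show "tseq n k = ltri_mult (ltri_toeplitz qq_inf) coprime_matrix n k"
  proof (cases "1 \<le> k")
    case True
    let ?H = "Abs_fps (\<lambda>x. of_bool (k < x \<and> coprime k x)) :: complex fps"
    have H: "fps_nth ?H (j + 1) = coprime_matrix j k" for j
      using True by (auto simp: coprime_matrix_def coprime_iff_gcd_eq_1 gcd.commute less_Suc_eq_le)
    have "tseq n k = (\<Sum>i=0..n + 1. fps_nth qq_inf i * fps_nth ?H (n + 1 - i))"
      unfolding tseq_conv_coeff[OF True] fps_mult_nth ..
    also have "\<dots> = (\<Sum>i\<in>{0..<n}. fps_nth qq_inf i * coprime_matrix (n - i) k)"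
    proof (rule sum.mono_neutral_cong_right)
      \<comment> \<open>The omitted indices \<open>n\<close> and \<open>n + 1\<close> meet the
        coefficients of \<open>?H\<close> at \<open>1\<close> and \<open>0\<close>, both zero as
        \<open>k \<ge> 1\<close>.\<close>
      show "\<forall>i\<in>{0..n + 1} - {0..<n}. fps_nth qq_inf i * fps_nth ?H (n + 1 - i) = 0"
        using True by auto
      fix i assume "i \<in> {0..<n}"
      hence "n + 1 - i = (n - i) + 1" by auto
      thus "fps_nth qq_inf i * fps_nth ?H (n + 1 - i) = fps_nth qq_inf i * coprime_matrix (n - i) k"
        using H[of "n - i"] by simp
    qed auto
    also have "\<dots> = (\<Sum>j=1..n. fps_nth qq_inf (n - j) * coprime_matrix j k)"
      by (rule sum.reindex_bij_witness[of _ "\<lambda>i. n - i" "\<lambda>j. n - j"]) auto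
    also have "\<dots> = ltri_mult (ltri_toeplitz qq_inf) coprime_matrix n k"
      unfolding ltri_mult_def by (intro sum.cong) (auto simp: ltri_toeplitz_def)
    finally show ?thesis .
  next
    case False
    thus ?thesis using tseq(1) lower_tri_mult[OF lower_tri_toeplitz coprime_matrix_ltri(1)]
      by (auto simp: lower_tri_def)
  qed
qed

section \<open>The entries of \<open>tseq\<close> and of its inverse\<close>

lemma tseq_pentagonal:
  assumes "1 \<le> k"
  shows "tseq n k = (\<Sum>j=0..n. (-1) powi \<lceil>real j / 2\<rceil> * principal_char k (int n + 1 - pent j)
    * of_bool (int n - pent j \<ge> int k))"
proof -
  define s :: "nat \<Rightarrow> complex" where "s j = (-1) ^ ((j + 1) div 2)" for j
  let ?E = "\<lambda>j. s j * principal_char k (int n + 1 - pent j) * of_bool (int n - pent j \<ge> int k)"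
  have inner: "(\<Sum>d=1..n. of_bool (pent j = int (n - d)) * coprime_matrix d k)
    = principal_char k (int n + 1 - pent j) * of_bool (int n - pent j \<ge> int k)" for j
  proof -
    \<comment> \<open>The only row that the exponent \<open>pent j\<close> can select;
      \<open>nat\<close> sends \<open>pent j > n\<close> to \<open>0\<close>, outside the range of
      \<open>d\<close>.\<close>
    define d0 where "d0 = nat (int n - pent j)"
    have p0: "pent j \<ge> 0" using pent_ge[of j] by linarith
    have "(\<Sum>d=1..n. of_bool (pent j = int (n - d)) * coprime_matrix d k)
      = (\<Sum>d=1..n. if d0 = d then coprime_matrix d k else 0)"
      by (intro sum.cong refl) (use p0 in \<open>auto simp: d0_def of_nat_diff\<close>)
    also have "\<dots> = of_bool (1 \<le> d0) * coprime_matrix d0 k"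
      using p0 by (subst sum.delta') (auto simp: d0_def)
    also have "\<dots> = principal_char k (int n + 1 - pent j) * of_bool (int n - pent j \<ge> int k)"
    proof (cases "int n - pent j \<ge> int k")
      case True
      hence d0: "int n + 1 - pent j = int (d0 + 1)" by (simp add: d0_def)
      have "principal_char k (int n + 1 - pent j) = of_bool (coprime (d0 + 1) k)"
        unfolding principal_char_def d0 coprime_int_iff ..
      moreover have "k \<le> d0" using True by (simp add: d0_def)
      ultimately show ?thesis using True assms by (simp add: coprime_matrix_def coprime_iff_gcd_eq_1)
    next
      case False
      hence "\<not> k \<le> d0" using assms by (simp add: d0_def)
      thus ?thesis using False by (simp add: coprime_matrix_def)
    qed
    finally show ?thesis .
  qed
  have "tseq n k = (\<Sum>d=1..n. fps_nth qq_inf (n - d) * coprime_matrix d k)"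
    unfolding tseq_factorization ltri_mult_def
    by (intro sum.cong) (auto simp: ltri_toeplitz_def)
  \<comment> \<open>All coefficients are expanded over the same range \<open>j \<le> 2 * n\<close>,
    whatever \<open>d\<close> is, so that the two sums can be swapped.\<close>
  also have "\<dots> = (\<Sum>d=1..n. \<Sum>j\<le>2 * n. s j * (of_bool (pent j = int (n - d)) * coprime_matrix d k))"
    by (intro sum.cong refl)
      (simp only: pentagonal_number_theorem[of _ n, OF diff_le_self] s_def sum_distrib_right mult.assoc)
  also have "\<dots> = (\<Sum>j\<le>2 * n. s j * (\<Sum>d=1..n. of_bool (pent j = int (n - d)) * coprime_matrix d k))"
    unfolding sum_distrib_left by (rule sum.swap)
  also have "\<dots> = (\<Sum>j\<le>2 * n. ?E j)"
    unfolding inner by (simp only: mult.assoc)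
  also have "\<dots> = (\<Sum>j=0..n. ?E j)"
  proof (rule sum.mono_neutral_right)
    have "\<not> int n - pent j \<ge> int k" if "j > n" for j
      using that pent_ge[of j] by linarith
    thus "\<forall>j\<in>{..2 * n} - {0..n}. ?E j = 0" by auto
  qed auto
  finally show ?thesis by (simp add: s_def ceiling_half_nat)
qed

lemma ltri_inverse_tseq:
  "ltri_inverse tseq = ltri_mult mu (ltri_toeplitz (inverse qq_inf))"
proof -
  have "inverse qq_inf * qq_inf = 1"
    by (rule inverse_mult_eq_1) (simp add: qq_inf_nth_0)
  thus ?thesis unfolding tseq_factorization
    by (intro ltri_inverse_mult)
      (simp_all add: lower_tri_toeplitz ltri_toeplitz_mult ltri_toeplitz_1 coprime_matrix_ltri mu
        mult.commute)
qed

theorem theorem3p43: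
  fixes n k :: nat
  assumes "1 \<le> k" and "k \<le> n"
  shows "tseq n k =
           (\<Sum>j=0..n. (-1) powi \<lceil>real j / 2\<rceil> * principal_char k (int n + 1 - pent j)
              * of_bool (int n - pent j \<ge> int k))
         \<and> ltri_inverse tseq n k =
           (\<Sum>d=1..n. partition_fun (int d - int k) * mu n d)"
proof
  show "ltri_inverse tseq n k = (\<Sum>d=1..n. partition_fun (int d - int k) * mu n d)"
    \<comment> \<open>For \<open>d < k\<close> both sides vanish: \<open>partition_fun\<close> is
      \<open>0\<close> at negative arguments, and the Toeplitz matrix is \<open>0\<close> above its
      diagonal.\<close>
    unfolding ltri_inverse_tseq ltri_mult_def
    by (intro sum.cong refl)
      (use assms in \<open>auto simp: ltri_toeplitz_def partition_fun_def nat_diff_distrib\<close>)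
qed (rule tseq_pentagonal[OF assms(1)])

end
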